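(* Let $a,b,m$ be positive integers. Then, as an identity in the variables $x_1,\dots,x_a,y$, $$\sum_{\pi\in\mathrm{PF}(a,b,m)}x_1^{\#1(\pi)}\cdots x_a^{\#a(\pi)}\,y^{\mathrm{lel}(\pi)}$$ $$=\sum_{j=1}^a x_jy\,(x_1+\cdots+x_{j-1}+x_jy+x_{j+1}+\cdots+x_a+b)\,(x_1+\cdots+x_{j-1}+x_jy+x_{j+1}+\cdots+x_a+mb)^{m-2}$$ $$\quad+\;b(m-1)(x_1+\cdots+x_a)\,y\,(x_1+\cdots+x_a+y+mb-1)^{m-2}.$$
   Context: $\mathrm{PF}(a,b,m)$ is the set of $(a,b)$-parking functions of length $m$: sequences $\pi=(\pi_1,\dots,\pi_m)$ of positive integers whose weakly increasing rearrangement $\lambda_1\le\cdots\le\lambda_m$ satisfies $\lambda_i\le a+(i-1)b$ for $1\le i\le m$. Here $\#i(\pi)=\#\{k:\pi_k=i\}$ and $\mathrm{lel}(\pi)=\#\{k:\pi_k=\pi_1\}$. For $m=1$ (exponent $-1$) the right-hand side is read as a rational function. *)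

theory Defs
  imports Complex_Main "HOL-Library.Poly_Mapping" "HOL-Computational_Algebra.Fraction_Field"
begin

definition parking_functions :: "nat \<Rightarrow> nat \<Rightarrow> nat \<Rightarrow> nat list set" where
  "parking_functions a b m =
     {\<pi>. length \<pi> = m \<and> (\<forall>k\<in>set \<pi>. 0 < k) \<and>
          (\<forall>i\<in>{1..m}. sort \<pi> ! (i - 1) \<le> a + (i - 1) * b)}"

lemma finite_parking_functions: "finite (parking_functions a b m)"
proof (rule finite_subset)
  show "parking_functions a b m \<subseteq> {\<pi>. set \<pi> \<subseteq> {..a + m * b} \<and> length \<pi> = m}"
  proof (rule subsetI, unfold mem_Collect_eq)
    fix \<pi>
    assume pf: "\<pi> \<in> parking_functions a b m"
    show "set \<pi> \<subseteq> {..a + m * b} \<and> length \<pi> = m"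
    proof (intro conjI subsetI)
      show len: "length \<pi> = m"
        using pf by (simp add: parking_functions_def)
      fix k assume "k \<in> set \<pi>"
      then have "k \<in> set (sort \<pi>)" by simp
      then obtain i where i: "i < m" "sort \<pi> ! i = k"
        using len by (metis in_set_conv_nth length_sort)
      have "\<forall>i\<in>{1..m}. sort \<pi> ! (i - 1) \<le> a + (i - 1) * b"
        using pf by (simp add: parking_functions_def)
      then have "sort \<pi> ! (Suc i - 1) \<le> a + (Suc i - 1) * b"
        by (rule bspec) (use i(1) in simp)
      then have "k \<le> a + i * b" using i by simp
      also have "\<dots> \<le> a + m * b" using i(1) by simp
      finally show "k \<in> {..a + m * b}" by simp
    qed
  qed
  show "finite {\<pi>. set \<pi> \<subseteq> {..a + m * b} \<and> length \<pi> = m}"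
    by (rule finite_lists_length_eq) simp
qed

text \<open>The number of entries equal to the first one; only meaningful for nonempty lists.\<close>

definition lel :: "nat list \<Rightarrow> nat" where
  "lel \<pi> = count_list \<pi> (hd \<pi>)"

text \<open>
  Polynomials over the rationals in countably many indeterminates: a monomial is its finitely
  supported exponent vector, a polynomial a finitely supported family of coefficients.
\<close>

type_synonym qpoly = "(nat \<Rightarrow>\<^sub>0 nat) \<Rightarrow>\<^sub>0 rat"

definition indet :: "nat \<Rightarrow> qpoly fract" where
  "indet i = Fract (Poly_Mapping.single (Poly_Mapping.single i 1) 1) 1"

text \<open>
  The indeterminate with index 0 plays the role of \<open>y\<close>; \<open>x\<^sub>1, x\<^sub>2, \<dots>\<close> are those with
  positive index, and \<open>var_x\<close> is only ever used at positive arguments.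
\<close>

definition var_x :: "nat \<Rightarrow> qpoly fract" where
  "var_x i = indet i"

definition var_y :: "qpoly fract" where
  "var_y = indet 0"

end

theory Submission
  imports Defs
begin

text \<open>
  Call a letter small if it is at most \<open>a\<close>, and let \<open>X = x\<^sub>1 + \<dots> + x\<^sub>a\<close>; large letters have
  weight 1. Everything rests on one decomposition: if \<open>s\<close> letters of a word are small, then their
  values do not matter for parking, and the word parks for \<open>(a, b)\<close> if and only if the subword of
  its large letters, shifted down by \<open>a\<close>, parks for \<open>(s b, b)\<close> (\<open>parks_split\<close>). The small and
  the large letters can be shuffled freely, so an enumerator over words of length \<open>n\<close> becomes a
  sum over \<open>s\<close> of \<open>(n choose s) X\<^sup>s\<close> times an enumerator of shorter words with unit weights.
  By induction on \<open>n\<close> and the binomial theorem, the weights of all parking words add up to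
  \<open>X (X + n b) ^ (n - 1)\<close> (\<open>sum_parking_words_weight\<close>).

  For the refinement by \<open>y\<close>, distinguish whether the first letter \<open>j\<close> is small.

  If it is, marking the copies of \<open>j\<close> means replacing \<open>x\<^sub>j\<close> by \<open>x\<^sub>j y\<close>, and deleting the first
  letter leaves an arbitrary parking word of length \<open>m - 1\<close> for \<open>(a + b, b)\<close>; its letters of
  value at most \<open>a + b\<close> have total weight \<open>X - x\<^sub>j + x\<^sub>j y + b\<close>. This gives the \<open>j\<close>-th summand
  (\<open>sum_first_small\<close>).

  If it is not, only the large letters see the mark (\<open>sum_first_large\<close>), and the enumerator of
  the words of large letters has unit weights. For \<open>A\<close> small letters and length \<open>n\<close> it is
  \<open>A y (A + y + n b - 1) ^ (n - 1)\<close> (\<open>lel_enumerator_unit_weights\<close>), again by induction on \<open>n\<close>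
  with the same two cases. Summing \<open>(m - 1 choose s) X\<^sup>s\<close> times its value for \<open>A = s b\<close> and
  \<open>n = m - s\<close> gives the last term of the formula.

  All of this takes place in an arbitrary commutative ring. Only the case \<open>m = 1\<close>, where an inverse
  occurs, refers to rational functions: there the inverted factor is nonzero because
  its constant term is \<open>b\<close>.
\<close>

section \<open>Words split into two classes of letters\<close>

definition words :: "'a set \<Rightarrow> nat \<Rightarrow> 'a list set" where
  "words S n = {w. set w \<subseteq> S \<and> length w = n}"

lemma finite_words: "finite S \<Longrightarrow> finite (words S n)"
  unfolding words_def by (rule finite_lists_length_eq)

lemma words_0 [simp]: "words S 0 = {[]}"
  by (auto simp: words_def)

lemma words_Suc: "words S (Suc n) = (\<lambda>(x, w). x # w) ` (S \<times> words S n)"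
  by (auto simp: words_def length_Suc_conv image_iff)

lemma sum_words_Suc:
  assumes "finite S"
  shows "(\<Sum>w\<in>words S (Suc n). f w) = (\<Sum>x\<in>S. \<Sum>w\<in>words S n. f (x # w))"
proof -
  have "(\<Sum>w\<in>words S (Suc n). f w) = (\<Sum>(x, w)\<in>S \<times> words S n. f (x # w))"
    unfolding words_Suc by (subst sum.reindex) (auto simp: inj_on_def case_prod_unfold)
  then show ?thesis
    by (simp add: sum.cartesian_product)
qed

lemma sum_words_prod_list:
  fixes u :: "'a \<Rightarrow> 'r::comm_semiring_1"
  assumes "finite S"
  shows "(\<Sum>w\<in>words S n. prod_list (map u w)) = (\<Sum>x\<in>S. u x) ^ n"
  by (induction n) (simp_all add: sum_words_Suc assms sum_distrib_left [symmetric] sum_distrib_right)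

lemma sum_filter_compl:
  assumes "finite S"
  shows "(\<Sum>x\<in>S. f x) = (\<Sum>x | x \<in> S \<and> P x. f x) + (\<Sum>x | x \<in> S \<and> \<not> P x. f x)"
proof -
  have "S = {x. x \<in> S \<and> P x} \<union> {x. x \<in> S \<and> \<not> P x}" by auto
  then show ?thesis
    using assms by (subst (1) \<open>S = _\<close>, subst sum.union_disjoint) auto
qed

text \<open>
  A word is a shuffle of its subword in \<open>P\<close> and its subword outside \<open>P\<close>, and two words of
  lengths \<open>s\<close> and \<open>n - s\<close> over disjoint alphabets have \<open>n choose s\<close> shuffles. The induction on
  \<open>n\<close> peels off the first letter, which turns Pascal's rule into the inductive step.
\<close>

lemma sum_words_shuffle:
  fixes h :: "'a list \<Rightarrow> 'a list \<Rightarrow> 'r::comm_semiring_1"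
    and P :: "'a \<Rightarrow> bool"
  assumes fin: "finite S"
  defines "A \<equiv> {x. x \<in> S \<and> P x}" and "B \<equiv> {x. x \<in> S \<and> \<not> P x}"
  shows "(\<Sum>w\<in>words S n. h (filter P w) (filter (\<lambda>x. \<not> P x) w)) =
    (\<Sum>s\<le>n. of_nat (n choose s) * (\<Sum>v\<in>words A s. \<Sum>w\<in>words B (n - s). h v w))"
proof (induction n arbitrary: h)
  case 0
  then show ?case by simp
next
  case (Suc n)
  have finA: "finite A" and finB: "finite B"
    using fin by (auto simp: A_def B_def)
  define H where "H s t = (\<Sum>v\<in>words A s. \<Sum>w\<in>words B t. h v w)" for s t
  have fst: "(\<Sum>x\<in>A. \<Sum>w\<in>words S n. h (x # filter P w) (filter (\<lambda>x. \<not> P x) w))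
      = (\<Sum>s\<le>n. of_nat (n choose s) * H (Suc s) (n - s))"
  proof -
    have "(\<Sum>x\<in>A. \<Sum>w\<in>words S n. h (x # filter P w) (filter (\<lambda>x. \<not> P x) w)) =
      (\<Sum>x\<in>A. \<Sum>s\<le>n. of_nat (n choose s) * (\<Sum>v\<in>words A s. \<Sum>w\<in>words B (n - s). h (x # v) w))"
      by (intro sum.cong refl, rule Suc.IH)
    also have "\<dots> = (\<Sum>s\<le>n. of_nat (n choose s) * H (Suc s) (n - s))"
      by (subst sum.swap) (simp add: H_def sum_words_Suc finA sum_distrib_left)
    finally show ?thesis .
  qed
  have snd: "(\<Sum>x\<in>B. \<Sum>w\<in>words S n. h (filter P w) (x # filter (\<lambda>x. \<not> P x) w))
      = (\<Sum>s\<le>n. of_nat (n choose s) * H s (Suc n - s))"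
  proof -
    have "(\<Sum>x\<in>B. \<Sum>w\<in>words S n. h (filter P w) (x # filter (\<lambda>x. \<not> P x) w)) =
      (\<Sum>x\<in>B. \<Sum>s\<le>n. of_nat (n choose s) * (\<Sum>v\<in>words A s. \<Sum>w\<in>words B (n - s). h v (x # w)))"
      by (intro sum.cong refl, rule Suc.IH)
    also have "\<dots> = (\<Sum>s\<le>n. of_nat (n choose s) *
        (\<Sum>v\<in>words A s. \<Sum>x\<in>B. \<Sum>w\<in>words B (n - s). h v (x # w)))"
      by (subst sum.swap, simp add: sum_distrib_left [symmetric], subst (2) sum.swap, rule refl)
    also have "\<dots> = (\<Sum>s\<le>n. of_nat (n choose s) * H s (Suc n - s))"
      by (intro sum.cong refl) (simp add: H_def Suc_diff_le sum_words_Suc finB)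
    finally show ?thesis .
  qed
  have "(\<Sum>w\<in>words S (Suc n). h (filter P w) (filter (\<lambda>x. \<not> P x) w)) =
     (\<Sum>x\<in>A. \<Sum>w\<in>words S n. h (x # filter P w) (filter (\<lambda>x. \<not> P x) w)) +
     (\<Sum>x\<in>B. \<Sum>w\<in>words S n. h (filter P w) (x # filter (\<lambda>x. \<not> P x) w))"
    unfolding sum_words_Suc [OF fin] sum_filter_compl [OF fin, where P = P]
    by (intro arg_cong2 [where f = "(+)"] sum.cong) (auto simp: A_def B_def)
  also have "\<dots> = (\<Sum>s\<le>n. of_nat (n choose s) * H (Suc s) (n - s)) +
      (\<Sum>s\<le>Suc n. of_nat (n choose s) * H s (Suc n - s))"
    by (simp add: fst snd binomial_eq_0)
  also have "\<dots> = (\<Sum>s\<le>Suc n. of_nat (Suc n choose s) * H s (Suc n - s))"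
    unfolding sum.atMost_Suc_shift by (simp add: sum.distrib distrib_right algebra_simps)
  finally show ?case by (simp add: H_def)
qed

text \<open>
  The same when the first letter is known to lie outside \<open>P\<close>: only the other \<open>n\<close> positions are
  free, hence the binomial coefficient \<open>n choose s\<close> for words of length \<open>n + 1\<close>.
\<close>

lemma sum_words_shuffle_hd:
  fixes h :: "'a list \<Rightarrow> 'a list \<Rightarrow> 'r::comm_semiring_1"
    and P :: "'a \<Rightarrow> bool"
  assumes fin: "finite S"
  defines "A \<equiv> {x. x \<in> S \<and> P x}" and "B \<equiv> {x. x \<in> S \<and> \<not> P x}"
  shows "(\<Sum>x\<in>B. \<Sum>w\<in>words S n. h (filter P (x # w)) (filter (\<lambda>x. \<not> P x) (x # w))) =
    (\<Sum>s\<le>n. of_nat (n choose s) * (\<Sum>v\<in>words A s. \<Sum>w\<in>words B (Suc n - s). h v w))"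
proof -
  have finB: "finite B"
    using fin by (auto simp: B_def)
  have "(\<Sum>x\<in>B. \<Sum>w\<in>words S n. h (filter P (x # w)) (filter (\<lambda>x. \<not> P x) (x # w))) =
    (\<Sum>x\<in>B. \<Sum>w\<in>words S n. h (filter P w) (x # filter (\<lambda>x. \<not> P x) w))"
    by (intro sum.cong) (auto simp: B_def)
  also have "\<dots> =
    (\<Sum>x\<in>B. \<Sum>s\<le>n. of_nat (n choose s) * (\<Sum>v\<in>words A s. \<Sum>w\<in>words B (n - s). h v (x # w)))"
    unfolding A_def B_def by (intro sum.cong refl, rule sum_words_shuffle [OF fin])
  also have "\<dots> = (\<Sum>s\<le>n. of_nat (n choose s) *
      (\<Sum>v\<in>words A s. \<Sum>x\<in>B. \<Sum>w\<in>words B (n - s). h v (x # w)))"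
    by (subst sum.swap, simp add: sum_distrib_left [symmetric], subst (2) sum.swap, rule refl)
  also have "\<dots> = (\<Sum>s\<le>n. of_nat (n choose s) *
      (\<Sum>v\<in>words A s. \<Sum>w\<in>words B (Suc n - s). h v w))"
    by (intro sum.cong refl) (simp add: Suc_diff_le sum_words_Suc finB)
  finally show ?thesis .
qed

section \<open>Parking words\<close>

text \<open>
  The condition on the sorted word in counting form, which is easy to follow when letters are
  deleted: the letter in place \<open>i\<close> (from 0) of the sorted word is at most \<open>t\<close> if and only if more
  than \<open>i\<close> letters are.
\<close>

definition parks :: "nat \<Rightarrow> nat \<Rightarrow> nat list \<Rightarrow> bool" where
  "parks a b w \<longleftrightarrow> (\<forall>i<length w. i < length (filter (\<lambda>k. k \<le> a + i * b) w))"

text \<open>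
  The lower bound \<open>c\<close> on the letters lets the large letters of a parking word form a parking
  word again without being shifted down. The upper bound on the letters follows from
  \<open>parks\<close>; it keeps the alphabet finite.
\<close>

definition parking_words :: "nat \<Rightarrow> nat \<Rightarrow> nat \<Rightarrow> nat \<Rightarrow> nat list set" where
  "parking_words c a b n = {w \<in> words {c<..a + n * b} n. parks a b w}"

lemma parking_words_0 [simp]: "parking_words c a b 0 = {[]}"
  by (auto simp: parking_words_def parks_def)

lemma sum_parking_words:
  "(\<Sum>w\<in>parking_words c a b n. f w) =
   (\<Sum>w\<in>words {c<..a + n * b} n. if parks a b w then f w else 0)"
  unfolding parking_words_def by (rule sum.inter_filter) (simp add: finite_words)

lemma nth_le_iff_less_length_filter:
  assumes "sorted xs" and "i < length xs"
  shows "xs ! i \<le> (t::'a::linorder) \<longleftrightarrow> i < length (filter (\<lambda>k. k \<le> t) xs)"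
  using assms
proof (induction xs arbitrary: i)
  case Nil
  then show ?case by simp
next
  case (Cons x xs)
  show ?case
  proof (cases "x \<le> t")
    case True
    then show ?thesis using Cons by (cases i) auto
  next
    case False
    have "t < (x # xs) ! i"
      using Cons.prems False by (cases i) (auto simp: not_le dest!: nth_mem intro: less_le_trans)
    moreover have "filter (\<lambda>k. k \<le> t) (x # xs) = []"
      using Cons.prems False by (auto simp: filter_empty_conv)
    ultimately show ?thesis by simp
  qed
qed

lemma parking_functions_eq_parking_words:
  "parking_functions a b m = parking_words 0 a b m"
proof -
  have cnt: "length (filter P (sort w)) = length (filter P w)" for P and w :: "nat list"
    by (simp add: filter_sort)
  have iff: "(\<forall>i\<in>{1..m}. sort w ! (i - 1) \<le> a + (i - 1) * b) \<longleftrightarrow> parks a b w"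
    if "length w = m" for w :: "nat list"
  proof -
    have "(\<forall>i\<in>{1..m}. sort w ! (i - 1) \<le> a + (i - 1) * b) \<longleftrightarrow>
        (\<forall>i<m. sort w ! i \<le> a + i * b)"
      unfolding image_Suc_lessThan [symmetric] by auto
    also have "\<dots> \<longleftrightarrow> parks a b w"
      using that nth_le_iff_less_length_filter [of "sort w"] by (simp add: parks_def cnt)
    finally show ?thesis .
  qed
  have bound: "k \<le> a + m * b" if "parks a b w" "length w = m" "k \<in> set w" for w k
  proof -
    have "m > 0" using that by (cases w) auto
    then have "m - 1 < length (filter (\<lambda>k. k \<le> a + (m - 1) * b) w)"
      using that unfolding parks_def by simp
    then have "length (filter (\<lambda>k. k \<le> a + (m - 1) * b) w) = length w"
      using that length_filter_le [of "\<lambda>k. k \<le> a + (m - 1) * b" w] by linarith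
    then have "k \<le> a + (m - 1) * b"
      using that by (metis length_filter_less less_irrefl)
    also have "\<dots> \<le> a + m * b" by simp
    finally show ?thesis .
  qed
  show ?thesis
    unfolding parking_functions_def parking_words_def words_def
    using iff bound by auto
qed

text \<open>
  Every small letter, whatever its value, takes one of the first \<open>s\<close> places of the sorted word,
  where the bounds are at least \<open>a\<close>; the large letters then face the remaining bounds
  \<open>a + s b, a + (s + 1) b, \<dots>\<close>.
\<close>

lemma parks_split:
  "parks a b w \<longleftrightarrow>
    parks (a + length (filter (\<lambda>k. k \<le> a) w) * b) b (filter (\<lambda>k. \<not> k \<le> a) w)"
proof -
  define s where "s = length (filter (\<lambda>k. k \<le> a) w)"
  define v where "v = filter (\<lambda>k. \<not> k \<le> a) w"
  have len: "length w = s + length v"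
    unfolding s_def v_def by (rule sum_length_filter_compl [symmetric])
  have cnt: "length (filter (\<lambda>k. k \<le> a + d) w) = s + length (filter (\<lambda>k. k \<le> a + d) v)" for d
    unfolding s_def v_def by (induction w) auto
  have "parks a b w \<longleftrightarrow> (\<forall>i<s + length v. i < s + length (filter (\<lambda>k. k \<le> a + i * b) v))"
    by (simp add: parks_def len cnt)
  also have "\<dots> \<longleftrightarrow> (\<forall>i<length v. i < length (filter (\<lambda>k. k \<le> a + (s + i) * b) v))"
  proof (intro iffI allI impI)
    fix i assume "\<forall>i<s + length v. i < s + length (filter (\<lambda>k. k \<le> a + i * b) v)" "i < length v"
    from this(1) [rule_format, of "s + i"] this(2)
    show "i < length (filter (\<lambda>k. k \<le> a + (s + i) * b) v)" by simp
  next
    fix i assume *: "\<forall>i<length v. i < length (filter (\<lambda>k. k \<le> a + (s + i) * b) v)"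
      and "i < s + length v"
    then show "i < s + length (filter (\<lambda>k. k \<le> a + i * b) v)"
    proof (cases "i < s")
      case False
      then have "s + (i - s) = i" "i - s < length v"
        using \<open>i < s + length v\<close> by auto
      with * [rule_format, of "i - s"] show ?thesis by simp
    qed simp
  qed
  also have "\<dots> \<longleftrightarrow> parks (a + s * b) b v"
    by (simp add: parks_def algebra_simps)
  finally show ?thesis by (simp add: s_def v_def)
qed

lemma parks_Cons_small:
  assumes "j \<le> a"
  shows "parks a b (j # w) \<longleftrightarrow> parks (a + b) b w"
proof -
  have "parks a b (j # w) \<longleftrightarrow> (\<forall>i<Suc (length w). i < Suc (length (filter (\<lambda>k. k \<le> a + i * b) w)))"
    using assms by (simp add: parks_def trans_le_add1)
  also have "\<dots> \<longleftrightarrow> (\<forall>i<length w. i < length (filter (\<lambda>k. k \<le> a + Suc i * b) w))"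
    by (simp only: All_less_Suc2) simp
  finally show ?thesis by (simp add: parks_def algebra_simps)
qed

text \<open>The first entry of the sorted word would have to be at most \<open>a\<close>.\<close>

lemma parking_words_no_small: "parking_words a a b (Suc n) = {}"
proof -
  have False if "parks a b w" "length w = Suc n" "set w \<subseteq> {a<..a + Suc n * b}" for w
  proof -
    have "filter (\<lambda>k. k \<le> a + 0 * b) w \<noteq> []"
      using that unfolding parks_def by (metis length_greater_0_conv zero_less_Suc)
    then show False
      using that by (auto simp: filter_empty_conv)
  qed
  then show ?thesis by (auto simp: parking_words_def words_def)
qed

lemma small_letters:
  fixes a c N :: nat
  assumes "a \<le> N"
  shows "{x. x \<in> {c<..N} \<and> x \<le> a} = {c<..a}"
  using assms by auto

lemma large_letters:
  fixes a c N :: nat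
  assumes "c \<le> a"
  shows "{x. x \<in> {c<..N} \<and> \<not> x \<le> a} = {a<..N}"
  using assms by auto

lemma sum_split_large:
  fixes F G :: "nat list \<Rightarrow> 'r::comm_ring_1"
  assumes "s \<le> n"
  shows "(\<Sum>v\<in>words {c<..a} s. \<Sum>w\<in>words {a<..a + n * b} (n - s).
      if parks (a + length v * b) b w then F v * G w else 0) =
    (\<Sum>v\<in>words {c<..a} s. F v) * (\<Sum>w\<in>parking_words a (a + s * b) b (n - s). G w)"
proof -
  have "a + s * b + (n - s) * b = a + n * b"
    using assms by (metis add.assoc add_mult_distrib le_add_diff_inverse)
  then have *: "(\<Sum>w\<in>parking_words a (a + s * b) b (n - s). G w) =
      (\<Sum>w\<in>words {a<..a + n * b} (n - s). if parks (a + s * b) b w then G w else 0)"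
    unfolding sum_parking_words by (simp only:)
  show ?thesis
    unfolding * sum_product
    by (intro sum.cong refl) (auto simp: words_def)
qed

lemma sum_parking_words_split:
  fixes F G :: "nat list \<Rightarrow> 'r::comm_ring_1"
  assumes ca: "c \<le> a"
  shows "(\<Sum>w\<in>parking_words c a b n.
      F (filter (\<lambda>k. k \<le> a) w) * G (filter (\<lambda>k. \<not> k \<le> a) w)) =
    (\<Sum>s\<le>n. of_nat (n choose s) *
      ((\<Sum>v\<in>words {c<..a} s. F v) * (\<Sum>w\<in>parking_words a (a + s * b) b (n - s). G w)))"
proof -
  let ?h = "\<lambda>v w. if parks (a + length v * b) b w then F v * G w else 0"
  have "(\<Sum>w\<in>parking_words c a b n.
      F (filter (\<lambda>k. k \<le> a) w) * G (filter (\<lambda>k. \<not> k \<le> a) w)) =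
    (\<Sum>w\<in>words {c<..a + n * b} n. ?h (filter (\<lambda>k. k \<le> a) w) (filter (\<lambda>k. \<not> k \<le> a) w))"
    unfolding sum_parking_words by (intro sum.cong refl if_cong parks_split)
  also have "\<dots> = (\<Sum>s\<le>n. of_nat (n choose s) *
      (\<Sum>v\<in>words {c<..a} s. \<Sum>w\<in>words {a<..a + n * b} (n - s). ?h v w))"
    using sum_words_shuffle [of "{c<..a + n * b}" ?h "\<lambda>k. k \<le> a" n]
    by (simp add: small_letters large_letters [OF ca] del: greaterThanAtMost_iff)
  also have "\<dots> = (\<Sum>s\<le>n. of_nat (n choose s) *
      ((\<Sum>v\<in>words {c<..a} s. F v) * (\<Sum>w\<in>parking_words a (a + s * b) b (n - s). G w)))"
    by (intro sum.cong refl) (simp add: sum_split_large)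
  finally show ?thesis .
qed

lemma sum_parking_words_split_hd:
  fixes F G :: "nat list \<Rightarrow> 'r::comm_ring_1"
  assumes ca: "c \<le> a"
  shows "(\<Sum>x\<in>{a<..a + Suc n * b}. \<Sum>w\<in>words {c<..a + Suc n * b} n.
      if parks a b (x # w)
      then F (filter (\<lambda>k. k \<le> a) (x # w)) * G (filter (\<lambda>k. \<not> k \<le> a) (x # w)) else 0) =
    (\<Sum>s\<le>n. of_nat (n choose s) *
      ((\<Sum>v\<in>words {c<..a} s. F v) * (\<Sum>w\<in>parking_words a (a + s * b) b (Suc n - s). G w)))"
    (is "?lhs = _")
proof -
  let ?h = "\<lambda>v w. if parks (a + length v * b) b w then F v * G w else 0"
  have "?lhs = (\<Sum>x\<in>{a<..a + Suc n * b}. \<Sum>w\<in>words {c<..a + Suc n * b} n.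
      ?h (filter (\<lambda>k. k \<le> a) (x # w)) (filter (\<lambda>k. \<not> k \<le> a) (x # w)))"
    by (intro sum.cong refl if_cong parks_split)
  also have "\<dots> = (\<Sum>s\<le>n. of_nat (n choose s) *
      (\<Sum>v\<in>words {c<..a} s. \<Sum>w\<in>words {a<..a + Suc n * b} (Suc n - s). ?h v w))"
  proof -
    have "a \<le> a + Suc n * b" by simp
    from sum_words_shuffle_hd [where S = "{c<..a + Suc n * b}" and P = "\<lambda>k. k \<le> a" and n = n and h = ?h,
        unfolded small_letters [OF this] large_letters [OF ca]]
    show ?thesis by blast
  qed
  also have "\<dots> = (\<Sum>s\<le>n. of_nat (n choose s) *
      ((\<Sum>v\<in>words {c<..a} s. F v) * (\<Sum>w\<in>parking_words a (a + s * b) b (Suc n - s). G w)))"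
  proof (rule sum.cong)
    fix s assume "s \<in> {..n}"
    then have "s \<le> Suc n" by simp
    from sum_split_large [OF this, where c = c and a = a and b = b and F = F and G = G]
    show "of_nat (n choose s) *
      (\<Sum>v\<in>words {c<..a} s. \<Sum>w\<in>words {a<..a + Suc n * b} (Suc n - s). ?h v w) =
      of_nat (n choose s) *
      ((\<Sum>v\<in>words {c<..a} s. F v) * (\<Sum>w\<in>parking_words a (a + s * b) b (Suc n - s). G w))"
      by simp
  qed simp
  finally show ?thesis .
qed

section \<open>Enumerators\<close>

lemma prod_list_filter_compl:
  fixes u :: "'a \<Rightarrow> 'r::comm_monoid_mult"
  shows "prod_list (map u w) =
    prod_list (map u (filter P w)) * prod_list (map u (filter (\<lambda>x. \<not> P x) w))"
  by (induction w) (auto simp: ac_simps)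

lemma prod_list_eq_1: "(\<And>k. k \<in> set w \<Longrightarrow> u k = (1::'r::comm_monoid_mult)) \<Longrightarrow> prod_list (map u w) = 1"
  by (induction w) auto

lemma sum_letters_beyond:
  fixes u :: "nat \<Rightarrow> 'r::comm_ring_1"
  assumes "c \<le> a" and "\<And>k. a < k \<Longrightarrow> u k = 1"
  shows "(\<Sum>k\<in>{c<..a + d}. u k) = (\<Sum>k\<in>{c<..a}. u k) + of_nat d"
proof -
  have "{c<..a + d} = {c<..a} \<union> {a<..a + d}"
    using assms by auto
  then show ?thesis
    using assms(2) by (simp add: sum.union_disjoint)
qed

text \<open>
  This is \<open>s * (n choose s) = n * (n - 1 choose s - 1)\<close> in generating-function form.
\<close>

lemma sum_binomial_times_index:
  fixes X Z :: "'r::comm_ring_1"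
  shows "(\<Sum>s\<le>n. of_nat (n choose s) * (X ^ s * (of_nat s * Z ^ (n - s)))) =
    of_nat n * X * (X + Z) ^ (n - 1)"
proof (cases n)
  case 0
  then show ?thesis by simp
next
  case (Suc k)
  have "(\<Sum>s\<le>n. of_nat (n choose s) * (X ^ s * (of_nat s * Z ^ (n - s)))) =
      (\<Sum>r\<le>k. of_nat (Suc r * (Suc k choose Suc r)) * (X ^ Suc r * Z ^ (k - r)))"
    unfolding Suc sum.atMost_Suc_shift by (simp add: algebra_simps)
  also have "\<dots> = of_nat n * X * (\<Sum>r\<le>k. of_nat (k choose r) * X ^ r * Z ^ (k - r))"
    unfolding Suc_times_binomial by (simp add: Suc sum_distrib_left algebra_simps)
  also have "\<dots> = of_nat n * X * (X + Z) ^ (n - 1)"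
    by (simp add: binomial_ring Suc)
  finally show ?thesis .
qed

text \<open>
  Splitting off the small letters expresses the enumerator through those of the shorter words of
  large letters, where every weight is 1. By induction these are \<open>s b (n b) ^ (n - s - 1)\<close> for
  \<open>0 < s < n\<close>, and the binomial theorem adds them up. No small letter at all (\<open>s = 0\<close>) is
  impossible, so the induction never returns to the length \<open>n\<close>.
\<close>

lemma sum_parking_words_weight:
  fixes u :: "nat \<Rightarrow> 'r::comm_ring_1"
  assumes "c \<le> a" and "\<And>k. a < k \<Longrightarrow> u k = 1"
  shows "(\<Sum>w\<in>parking_words c a b n. prod_list (map u w)) =
    (if n = 0 then 1 else (\<Sum>k\<in>{c<..a}. u k) * ((\<Sum>k\<in>{c<..a}. u k) + of_nat (n * b)) ^ (n - 1))"
  using assms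
proof (induction n arbitrary: c a rule: less_induct)
  case (less n)
  show ?case
  proof (cases n)
    case 0
    then show ?thesis by simp
  next
    case (Suc m)
    define X where "X = (\<Sum>k\<in>{c<..a}. u k)"
    define R where "R s = (\<Sum>w\<in>parking_words a (a + s * b) b (n - s). prod_list (map u w))" for s
    have R0: "R 0 = 0"
      by (simp add: R_def Suc parking_words_no_small)
    have RSuc: "of_nat (n choose Suc r) * R (Suc r) = of_nat (m choose r) * of_nat (n * b) ^ (m - r)"
      if "r \<le> m" for r
    proof (cases "r = m")
      case True
      then show ?thesis by (simp add: R_def Suc)
    next
      case False
      with that have "r < m" by simp
      have U: "(\<Sum>k\<in>{a<..a + Suc r * b}. u k) = of_nat (Suc r * b)"
        using less.prems(2) by simp
      have "R (Suc r) = of_nat (Suc r * b) *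
          (of_nat (Suc r * b) + of_nat ((n - Suc r) * b)) ^ (n - Suc r - 1)"
        unfolding R_def using less.IH [of "n - Suc r" a "a + Suc r * b"] less.prems(2) \<open>r < m\<close>
        by (simp add: Suc U del: of_nat_mult mult_Suc)
      also have "of_nat (Suc r * b) + of_nat ((n - Suc r) * b) = (of_nat (n * b) :: 'r)"
        using \<open>r < m\<close> Suc
        by (metis add_mult_distrib le_add_diff_inverse less_imp_le_nat not_less_eq of_nat_add)
      also have "n - Suc r - 1 = m - r - 1"
        using Suc by simp
      finally have "of_nat (n choose Suc r) * R (Suc r) =
          of_nat (Suc r * (n choose Suc r)) * of_nat b * of_nat (n * b) ^ (m - r - 1)"
        by (simp add: algebra_simps)
      also have "\<dots> = of_nat (m choose r) * (of_nat (n * b) * of_nat (n * b) ^ (m - r - 1))"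
        unfolding Suc Suc_times_binomial by (simp add: algebra_simps)
      also have "of_nat (n * b) * of_nat (n * b) ^ (m - r - 1) = (of_nat (n * b) :: 'r) ^ (m - r)"
        using \<open>r < m\<close> by (simp add: Suc_diff_Suc flip: power_Suc del: of_nat_mult)
      finally show ?thesis .
    qed
    have "(\<Sum>w\<in>parking_words c a b n. prod_list (map u w)) =
        (\<Sum>w\<in>parking_words c a b n. prod_list (map u (filter (\<lambda>k. k \<le> a) w)) *
          prod_list (map u (filter (\<lambda>k. \<not> k \<le> a) w)))"
      by (intro sum.cong refl prod_list_filter_compl)
    also have "\<dots> = (\<Sum>s\<le>n. of_nat (n choose s) *
        ((\<Sum>v\<in>words {c<..a} s. prod_list (map u v)) * R s))"
      unfolding R_def by (rule sum_parking_words_split [OF less.prems(1)])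
    also have "\<dots> = (\<Sum>s\<le>n. of_nat (n choose s) * (X ^ s * R s))"
      by (simp add: sum_words_prod_list X_def)
    also have "\<dots> = (\<Sum>r\<le>m. X ^ Suc r * (of_nat (n choose Suc r) * R (Suc r)))"
      unfolding Suc sum.atMost_Suc_shift by (simp add: R0 algebra_simps)
    also have "\<dots> = (\<Sum>r\<le>m. X ^ Suc r * (of_nat (m choose r) * of_nat (n * b) ^ (m - r)))"
      using RSuc by simp
    also have "\<dots> = X * (X + of_nat (n * b)) ^ m"
      by (simp add: binomial_ring sum_distrib_left algebra_simps del: of_nat_mult)
    finally show ?thesis
      by (simp add: Suc X_def)
  qed
qed

text \<open>
  The left-hand side of the formula is the case \<open>c = 0\<close>, with \<open>u\<close> sending the small letters to
  their indeterminates and the large ones to 1. Splitting off small letters leads to \<open>c > 0\<close>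
  and to the constant weight 1.
\<close>

definition lel_enumerator ::
    "(nat \<Rightarrow> 'r::comm_ring_1) \<Rightarrow> 'r \<Rightarrow> nat \<Rightarrow> nat \<Rightarrow> nat \<Rightarrow> nat \<Rightarrow> 'r" where
  "lel_enumerator u y c a b n = (\<Sum>w\<in>parking_words c a b n. prod_list (map u w) * y ^ lel w)"

text \<open>
  If the first letter \<open>j\<close> is small, then marking it amounts to replacing its weight \<open>u j\<close> by
  \<open>u j * y\<close>. Deleting it leaves an arbitrary parking word for \<open>a + b\<close> in place of \<open>a\<close>.
  The value 1 for \<open>n = 0\<close> is what \<open>(X + b) * (X + b) ^ (-1)\<close> means for rational functions.
\<close>

lemma sum_first_small:
  fixes u :: "nat \<Rightarrow> 'r::comm_ring_1" and y :: 'r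
  assumes "c < j" and "j \<le> a" and u1: "\<And>k. a < k \<Longrightarrow> u k = 1"
  defines "X \<equiv> (\<Sum>k\<in>{c<..a}. (u(j := u j * y)) k)"
  shows "(\<Sum>w\<in>words {c<..a + Suc n * b} n.
      if parks a b (j # w) then prod_list (map u (j # w)) * y ^ lel (j # w) else 0) =
    u j * y * (if n = 0 then 1 else (X + of_nat b) * (X + of_nat (Suc n * b)) ^ (n - 1))"
proof -
  let ?v = "u(j := u j * y)"
  have marked: "prod_list (map u w) * y ^ count_list w j = prod_list (map ?v w)" for w
    by (induction w) (auto simp: ac_simps)
  have weight: "prod_list (map u (j # w)) * y ^ lel (j # w) = u j * y * prod_list (map ?v w)" for w
    unfolding marked [symmetric] by (simp add: lel_def ac_simps)
  have alphabet: "a + Suc n * b = a + b + n * b"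
    by simp
  have v1: "?v k = 1" if "a < k" for k
    using that assms by auto
  have v1': "?v k = 1" if "a + b < k" for k
    using that by (intro v1) simp
  have sumv: "(\<Sum>k\<in>{c<..a + b}. ?v k) = X + of_nat b"
    unfolding X_def using assms(1,2) by (intro sum_letters_beyond v1) auto
  have "(\<Sum>w\<in>words {c<..a + Suc n * b} n.
      if parks a b (j # w) then prod_list (map u (j # w)) * y ^ lel (j # w) else 0) =
    (\<Sum>w\<in>words {c<..a + b + n * b} n. if parks (a + b) b w then u j * y * prod_list (map ?v w) else 0)"
    unfolding alphabet parks_Cons_small [OF assms(2)] weight by (rule refl)
  also have "\<dots> = (\<Sum>w\<in>parking_words c (a + b) b n. u j * y * prod_list (map ?v w))"
    by (rule sum_parking_words [symmetric])
  also have "\<dots> = u j * y * (\<Sum>w\<in>parking_words c (a + b) b n. prod_list (map ?v w))"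
    by (simp only: sum_distrib_left)
  also have "(\<Sum>w\<in>parking_words c (a + b) b n. prod_list (map ?v w)) =
      (if n = 0 then 1 else (X + of_nat b) * (X + of_nat (Suc n * b)) ^ (n - 1))"
    using assms(1,2)
    by (subst sum_parking_words_weight [OF _ v1']) (simp_all only: sumv, simp_all add: add.assoc)
  finally show ?thesis .
qed

text \<open>
  If the first letter is large, it also comes first among the large letters, and all its
  copies are large: the exponent of \<open>y\<close> depends on the subword of large letters alone.
\<close>

lemma sum_first_large:
  fixes u :: "nat \<Rightarrow> 'r::comm_ring_1"
  assumes "c \<le> a" and u1: "\<And>k. a < k \<Longrightarrow> u k = 1"
  shows "(\<Sum>j\<in>{a<..a + Suc n * b}. \<Sum>w\<in>words {c<..a + Suc n * b} n.
      if parks a b (j # w) then prod_list (map u (j # w)) * y ^ lel (j # w) else 0) =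
    (\<Sum>s\<le>n. of_nat (n choose s) * ((\<Sum>k\<in>{c<..a}. u k) ^ s *
      lel_enumerator (\<lambda>_. 1) y a (a + s * b) b (Suc n - s)))"
    (is "?lhs = _")
proof -
  have weight: "prod_list (map u (j # w)) * y ^ lel (j # w) =
      prod_list (map u (filter (\<lambda>k. k \<le> a) (j # w))) * y ^ lel (filter (\<lambda>k. \<not> k \<le> a) (j # w))"
    if "j \<in> {a<..a + Suc n * b}" for j w
  proof -
    have "lel (filter (\<lambda>k. \<not> k \<le> a) (j # w)) = lel (j # w)"
      using that unfolding lel_def by (induction w) auto
    moreover have "prod_list (map u (filter (\<lambda>k. \<not> k \<le> a) (j # w))) = 1"
      using that by (intro prod_list_eq_1) (auto intro: u1 split: if_splits)
    ultimately show ?thesis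
      by (subst prod_list_filter_compl [where P = "\<lambda>k. k \<le> a"]) (simp only: mult_1_right)
  qed
  have "?lhs = (\<Sum>j\<in>{a<..a + Suc n * b}. \<Sum>w\<in>words {c<..a + Suc n * b} n.
      if parks a b (j # w)
      then prod_list (map u (filter (\<lambda>k. k \<le> a) (j # w))) * y ^ lel (filter (\<lambda>k. \<not> k \<le> a) (j # w))
      else 0)"
    by (intro sum.cong refl if_cong weight)
  also have "\<dots> = (\<Sum>s\<le>n. of_nat (n choose s) *
      ((\<Sum>v\<in>words {c<..a} s. prod_list (map u v)) *
       (\<Sum>w\<in>parking_words a (a + s * b) b (Suc n - s). y ^ lel w)))"
    by (rule sum_parking_words_split_hd [OF assms(1)])
  also have "\<dots> = (\<Sum>s\<le>n. of_nat (n choose s) * ((\<Sum>k\<in>{c<..a}. u k) ^ s *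
      lel_enumerator (\<lambda>_. 1) y a (a + s * b) b (Suc n - s)))"
    by (simp add: sum_words_prod_list lel_enumerator_def prod_list_eq_1)
  finally show ?thesis .
qed

lemma lel_enumerator_first_letter:
  fixes u :: "nat \<Rightarrow> 'r::comm_ring_1" and y :: 'r
  assumes "c \<le> a" and u1: "\<And>k. a < k \<Longrightarrow> u k = 1"
  defines "X \<equiv> \<lambda>j. \<Sum>k\<in>{c<..a}. (u(j := u j * y)) k"
  shows "lel_enumerator u y c a b (Suc n) =
    (\<Sum>j\<in>{c<..a}. u j * y *
       (if n = 0 then 1 else (X j + of_nat b) * (X j + of_nat (Suc n * b)) ^ (n - 1))) +
    (\<Sum>s\<le>n. of_nat (n choose s) * ((\<Sum>k\<in>{c<..a}. u k) ^ s *
      lel_enumerator (\<lambda>_. 1) y a (a + s * b) b (Suc n - s)))"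
proof -
  define f where "f j = (\<Sum>w\<in>words {c<..a + Suc n * b} n.
      if parks a b (j # w) then prod_list (map u (j # w)) * y ^ lel (j # w) else 0)" for j
  have "{c<..a + Suc n * b} = {c<..a} \<union> {a<..a + Suc n * b}"
    using assms(1) by auto
  moreover have "lel_enumerator u y c a b (Suc n) = (\<Sum>j\<in>{c<..a + Suc n * b}. f j)"
    unfolding lel_enumerator_def sum_parking_words f_def by (rule sum_words_Suc) simp
  ultimately have "lel_enumerator u y c a b (Suc n) =
      (\<Sum>j\<in>{c<..a}. f j) + (\<Sum>j\<in>{a<..a + Suc n * b}. f j)"
    by (simp only:) (rule sum.union_disjoint, auto)
  moreover have "(\<Sum>j\<in>{c<..a}. f j) = (\<Sum>j\<in>{c<..a}. u j * y *
       (if n = 0 then 1 else (X j + of_nat b) * (X j + of_nat (Suc n * b)) ^ (n - 1)))"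
    unfolding f_def X_def by (intro sum.cong refl sum_first_small u1) auto
  moreover have "(\<Sum>j\<in>{a<..a + Suc n * b}. f j) =
    (\<Sum>s\<le>n. of_nat (n choose s) * ((\<Sum>k\<in>{c<..a}. u k) ^ s *
      lel_enumerator (\<lambda>_. 1) y a (a + s * b) b (Suc n - s)))"
    unfolding f_def using assms(1) by (intro sum_first_large u1) auto
  ultimately show ?thesis by simp
qed

text \<open>
  The contribution of the words of length \<open>n + 1\<close> whose first letter is large. The assumption is
  the formula for unit weights at the shorter lengths \<open>n + 1 - s\<close>: an induction hypothesis when
  that formula is being proved, and the formula itself afterwards. Its base does not depend on \<open>s\<close>,
  as \<open>s b + (n + 1 - s) b = (n + 1) b\<close>.
\<close>

lemma sum_over_small_letters:
  fixes X y :: "'r::comm_ring_1"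
  assumes "\<And>s. 0 < s \<Longrightarrow> s \<le> n \<Longrightarrow> lel_enumerator (\<lambda>_. 1) y a (a + s * b) b (Suc n - s) =
    of_nat (s * b) * y * (of_nat (s * b) + y + of_nat ((Suc n - s) * b) - 1) ^ (n - s)"
  shows "(\<Sum>s\<le>n. of_nat (n choose s) *
      (X ^ s * lel_enumerator (\<lambda>_. 1) y a (a + s * b) b (Suc n - s))) =
    of_nat (b * n) * X * y * (X + y + of_nat (Suc n * b) - 1) ^ (n - 1)"
proof -
  define Z where "Z = y + of_nat (Suc n * b) - 1"
  have G: "lel_enumerator (\<lambda>_. 1) y a (a + s * b) b (Suc n - s) = of_nat b * y * (of_nat s * Z ^ (n - s))"
    if "s \<le> n" for s
  proof (cases "s = 0")
    case True
    then show ?thesis by (simp add: lel_enumerator_def parking_words_no_small)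
  next
    case False
    have "s * b + (Suc n - s) * b = Suc n * b"
      using that by (metis add_mult_distrib le_SucI le_add_diff_inverse)
    then have "of_nat (s * b) + of_nat ((Suc n - s) * b) = (of_nat (Suc n * b) :: 'r)"
      by (metis of_nat_add)
    moreover have "of_nat (s * b) + y + of_nat ((Suc n - s) * b) - 1 =
        y + (of_nat (s * b) + of_nat ((Suc n - s) * b)) - 1"
      by (simp only: ac_simps)
    ultimately have Z: "of_nat (s * b) + y + of_nat ((Suc n - s) * b) - 1 = Z"
      unfolding Z_def by metis
    have "lel_enumerator (\<lambda>_. 1) y a (a + s * b) b (Suc n - s) = of_nat (s * b) * y * Z ^ (n - s)"
      using assms [of s] False that unfolding Z by simp
    then show ?thesis
      by (simp only: of_nat_mult ac_simps)
  qed
  have "(\<Sum>s\<le>n. of_nat (n choose s) *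
      (X ^ s * lel_enumerator (\<lambda>_. 1) y a (a + s * b) b (Suc n - s))) =
    of_nat b * y * (\<Sum>s\<le>n. of_nat (n choose s) * (X ^ s * (of_nat s * Z ^ (n - s))))"
    unfolding sum_distrib_left by (intro sum.cong refl) (simp add: G ac_simps)
  also have "\<dots> = of_nat (b * n) * X * y * (X + Z) ^ (n - 1)"
    unfolding sum_binomial_times_index by (simp add: ac_simps)
  finally show ?thesis
    by (simp only: Z_def add.assoc [symmetric] add_diff_eq)
qed

text \<open>
  Put \<open>A = a - c\<close>. For \<open>n \<ge> 2\<close> the words whose first letter is small and those whose first letter
  is large both contribute a multiple of \<open>A y (A + y + n b - 1) ^ (n - 2)\<close>, and the cofactors
  \<open>A - 1 + y + b\<close> and \<open>b (n - 1)\<close> add up to \<open>A + y + n b - 1\<close>.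
\<close>

lemma lel_enumerator_unit_weights:
  fixes y :: "'r::comm_ring_1"
  assumes "c \<le> a" and "0 < n"
  shows "lel_enumerator (\<lambda>_. 1) y c a b n =
    of_nat (a - c) * y * (of_nat (a - c) + y + of_nat (n * b) - 1) ^ (n - 1)"
  using assms
proof (induction n arbitrary: c a rule: less_induct)
  case (less n)
  then obtain m where n: "n = Suc m"
    by (cases n) auto
  define A :: 'r where "A = of_nat (a - c)"
  have marked: "(\<Sum>k\<in>{c<..a}. ((\<lambda>_. 1)(j := y)) k) = A - 1 + y" if "j \<in> {c<..a}" for j
  proof -
    have "(\<Sum>k\<in>{c<..a}. ((\<lambda>_. 1)(j := y)) k) = y + (\<Sum>k\<in>{c<..a} - {j}. 1)"
      using that by (subst sum.remove [of _ j]) auto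
    also have "(\<Sum>k\<in>{c<..a} - {j}. 1) = A - 1"
      using that by (simp add: A_def of_nat_diff)
    finally show ?thesis by simp
  qed
  have "lel_enumerator (\<lambda>_. 1) y c a b n =
    (\<Sum>j\<in>{c<..a}. y * (if m = 0 then 1
       else (A - 1 + y + of_nat b) * (A - 1 + y + of_nat (Suc m * b)) ^ (m - 1))) +
    (\<Sum>s\<le>m. of_nat (m choose s) * (A ^ s *
      lel_enumerator (\<lambda>_. 1) y a (a + s * b) b (Suc m - s)))"
  proof -
    have one: "(\<Sum>k\<in>{c<..a}. 1) = A"
      by (simp add: A_def)
    show ?thesis
      unfolding n lel_enumerator_first_letter [OF less.prems(1) refl] one
      by (intro arg_cong2 [where f = "(+)"] sum.cong refl) (simp only: marked mult_1_left)
  qed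
  also have "(\<Sum>s\<le>m. of_nat (m choose s) * (A ^ s *
      lel_enumerator (\<lambda>_. 1) y a (a + s * b) b (Suc m - s))) =
      of_nat (b * m) * A * y * (A + y + of_nat (Suc m * b) - 1) ^ (m - 1)"
  proof (rule sum_over_small_letters)
    fix s assume "0 < s" "s \<le> m"
    then show "lel_enumerator (\<lambda>_. 1) y a (a + s * b) b (Suc m - s) =
      of_nat (s * b) * y * (of_nat (s * b) + y + of_nat ((Suc m - s) * b) - 1) ^ (m - s)"
      using less.IH [of "Suc m - s" a "a + s * b"] by (simp add: n)
  qed
  also have "(\<Sum>j\<in>{c<..a}. y * (if m = 0 then 1
       else (A - 1 + y + of_nat b) * (A - 1 + y + of_nat (Suc m * b)) ^ (m - 1))) +
      of_nat (b * m) * A * y * (A + y + of_nat (Suc m * b) - 1) ^ (m - 1) =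
      A * y * (A + y + of_nat (Suc m * b) - 1) ^ m"
  proof (cases m)
    case 0
    then show ?thesis by (simp add: A_def)
  next
    case (Suc k)
    have const: "(\<Sum>j\<in>{c<..a}. t) = A * t" for t
      by (simp add: A_def)
    define Z where "Z = A + y + of_nat (Suc m * b) - 1"
    have Z1: "A - 1 + y + of_nat (Suc m * b) = Z"
      by (simp add: Z_def)
    have Z2: "A - 1 + y + of_nat b + of_nat (b * m) = Z"
      by (simp add: Z_def algebra_simps)
    have "A * (y * ((A - 1 + y + of_nat b) * Z ^ k)) + of_nat (b * m) * A * y * Z ^ k =
        A * y * ((A - 1 + y + of_nat b + of_nat (b * m)) * Z ^ k)"
      by (simp only: distrib_left distrib_right ac_simps)
    also have "\<dots> = A * y * Z ^ m"
      unfolding Z2 by (simp add: Suc)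
    finally show ?thesis
      unfolding Z1 Z_def [symmetric] const by (simp add: Suc)
  qed
  finally show ?case
    by (simp add: n A_def)
qed

text \<open>
  The formula in any commutative ring. Length 1 is excluded: subtraction of naturals would read
  the exponent \<open>-1\<close> as 0.
\<close>

lemma lel_enumerator_eq:
  fixes u :: "nat \<Rightarrow> 'r::comm_ring_1" and y :: 'r
  assumes "c \<le> a" and u1: "\<And>k. a < k \<Longrightarrow> u k = 1" and "2 \<le> n"
  defines "X \<equiv> \<lambda>j. \<Sum>k\<in>{c<..a}. (u(j := u j * y)) k"
  shows "lel_enumerator u y c a b n =
    (\<Sum>j\<in>{c<..a}. u j * y * (X j + of_nat b) * (X j + of_nat (n * b)) ^ (n - 2)) +
    of_nat (b * (n - 1)) * (\<Sum>k\<in>{c<..a}. u k) * y *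
      ((\<Sum>k\<in>{c<..a}. u k) + y + of_nat (n * b) - 1) ^ (n - 2)"
proof -
  obtain m where n: "n = Suc m" "m > 0"
    using assms(3) by (cases n) auto
  have "lel_enumerator u y c a b n =
    (\<Sum>j\<in>{c<..a}. u j * y * ((X j + of_nat b) * (X j + of_nat (Suc m * b)) ^ (m - 1))) +
    (\<Sum>s\<le>m. of_nat (m choose s) * ((\<Sum>k\<in>{c<..a}. u k) ^ s *
      lel_enumerator (\<lambda>_. 1) y a (a + s * b) b (Suc m - s)))"
    unfolding n(1) X_def
    by (simp only: lel_enumerator_first_letter [OF assms(1) u1] n(2) [THEN gr_implies_not0] if_False)
  also have "(\<Sum>s\<le>m. of_nat (m choose s) * ((\<Sum>k\<in>{c<..a}. u k) ^ s *
      lel_enumerator (\<lambda>_. 1) y a (a + s * b) b (Suc m - s))) =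
      of_nat (b * m) * (\<Sum>k\<in>{c<..a}. u k) * y *
      ((\<Sum>k\<in>{c<..a}. u k) + y + of_nat (Suc m * b) - 1) ^ (m - 1)"
  proof (rule sum_over_small_letters)
    fix s assume "0 < s" "s \<le> m"
    then show "lel_enumerator (\<lambda>_. 1) y a (a + s * b) b (Suc m - s) =
      of_nat (s * b) * y * (of_nat (s * b) + y + of_nat ((Suc m - s) * b) - 1) ^ (m - s)"
      using lel_enumerator_unit_weights [of a "a + s * b" "Suc m - s" y b] by simp
  qed
  finally show ?thesis
    by (simp add: n mult.assoc)
qed

section \<open>The formula in the field of rational functions\<close>

text \<open>
  In length 1 the factor with exponent \<open>-1\<close> has to cancel against the one before it, so it must be
  nonzero. It is \<open>b\<close> plus an element of the following kind, hence has constant term \<open>b\<close>.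
\<close>

definition no_constant_term :: "qpoly fract \<Rightarrow> bool" where
  "no_constant_term f \<longleftrightarrow> (\<exists>p. f = Fract p 1 \<and> Poly_Mapping.lookup p 0 = 0)"

lemma no_constant_term_0: "no_constant_term 0"
  unfolding no_constant_term_def by (intro exI [of _ 0]) (simp add: Zero_fract_def)

lemma no_constant_term_add:
  assumes "no_constant_term f" and "no_constant_term g"
  shows "no_constant_term (f + g)"
proof -
  from assms obtain p q where "f = Fract p 1" "Poly_Mapping.lookup p 0 = 0" "g = Fract q 1" "Poly_Mapping.lookup q 0 = 0"
    by (auto simp: no_constant_term_def)
  then show ?thesis
    unfolding no_constant_term_def by (intro exI [of _ "p + q"]) (simp add: lookup_add)
qed

lemma no_constant_term_sum: "(\<And>i. i \<in> S \<Longrightarrow> no_constant_term (f i)) \<Longrightarrow> no_constant_term (sum f S)"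
  by (induction S rule: infinite_finite_induct)
     (auto intro: no_constant_term_0 no_constant_term_add)

lemma no_constant_term_indet: "no_constant_term (indet i)"
proof -
  have "Poly_Mapping.single i (1::nat) \<noteq> 0"
    by (metis lookup_single_eq lookup_zero zero_neq_one)
  then show ?thesis
    unfolding no_constant_term_def indet_def
    by (intro exI [of _ "Poly_Mapping.single (Poly_Mapping.single i 1) 1"])
       (simp add: lookup_single when_def)
qed

lemma no_constant_term_indet_mult: "no_constant_term (indet i * indet j)"
proof -
  have "Poly_Mapping.single i 1 + Poly_Mapping.single j (1::nat) \<noteq> 0"
  proof
    assume "Poly_Mapping.single i 1 + Poly_Mapping.single j (1::nat) = 0"
    then have "Poly_Mapping.lookup (Poly_Mapping.single i 1 + Poly_Mapping.single j (1::nat)) i = 0"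
      by simp
    then show False
      by (simp add: lookup_add)
  qed
  then show ?thesis
    unfolding no_constant_term_def indet_def
    by (intro exI [of _ "Poly_Mapping.single (Poly_Mapping.single i 1 + Poly_Mapping.single j 1) 1"])
       (simp add: mult_single lookup_single when_def)
qed

lemma no_constant_term_plus_of_nat_nonzero:
  assumes "no_constant_term f" and "0 < b"
  shows "f + of_nat b \<noteq> 0"
proof
  assume *: "f + of_nat b = 0"
  from assms obtain p where p: "f = Fract p 1" "Poly_Mapping.lookup p 0 = 0"
    by (auto simp: no_constant_term_def)
  have "f + of_nat b = Fract (p + of_nat b) 1"
    by (simp add: p of_nat_fract)
  with * have "p + of_nat b = 0"
    by (simp add: Zero_fract_def eq_fract)
  then have "Poly_Mapping.lookup (p + of_nat b) 0 = 0"
    by simp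
  with p(2) assms(2) show False
    by (simp add: lookup_add lookup_of_nat)
qed

lemma sum_marked_letter:
  fixes x :: "nat \<Rightarrow> 'r::comm_ring_1"
  assumes "j \<in> {1..a}"
  shows "(\<Sum>k\<in>{0<..a}. (x(j := z)) k) = (\<Sum>i=1..<j. x i) + z + (\<Sum>i=j+1..a. x i)"
proof -
  have "{0<..a} - {j} = {1..<j} \<union> {j+1..a}"
    using assms by auto
  moreover have "(\<Sum>k\<in>{0<..a}. (x(j := z)) k) = z + (\<Sum>k\<in>{0<..a} - {j}. x k)"
    using assms by (subst sum.remove [of _ j]) (auto intro: sum.cong)
  moreover have "sum x ({1..<j} \<union> {j+1..a}) = (\<Sum>i=1..<j. x i) + (\<Sum>i=j+1..a. x i)"
    by (rule sum.union_disjoint) auto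
  ultimately show ?thesis
    by (simp add: ac_simps)
qed

lemma prod_list_letters_eq_prod_count:
  fixes x :: "nat \<Rightarrow> 'r::comm_monoid_mult"
  assumes "0 \<notin> set w"
  shows "prod_list (map (\<lambda>k. if k \<le> a then x k else 1) w) = (\<Prod>i=1..a. x i ^ count_list w i)"
  using assms
proof (induction w)
  case Nil
  then show ?case by simp
next
  case (Cons k w)
  have "(\<Prod>i=1..a. x i ^ count_list (k # w) i) =
      (\<Prod>i=1..a. (if i = k then x k else 1) * x i ^ count_list w i)"
    by (intro prod.cong) auto
  also have "\<dots> = (if k \<le> a then x k else 1) * (\<Prod>i=1..a. x i ^ count_list w i)"
    using Cons.prems by (auto simp: prod.distrib)
  finally show ?case
    using Cons by simp
qed

theorem proposition7p5:
  fixes a b m :: nat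
  assumes "0 < a" and "0 < b" and "0 < m"
  shows
    "(\<Sum>\<pi>\<in>parking_functions a b m. (\<Prod>i=1..a. var_x i ^ count_list \<pi> i) * var_y ^ lel \<pi>) =
     (\<Sum>j=1..a. var_x j * var_y
        * ((\<Sum>i=1..<j. var_x i) + var_x j * var_y + (\<Sum>i=j+1..a. var_x i) + of_nat b)
        * ((\<Sum>i=1..<j. var_x i) + var_x j * var_y + (\<Sum>i=j+1..a. var_x i) + of_nat (m * b))
            powi (int m - 2))
     + of_nat (b * (m - 1)) * (\<Sum>i=1..a. var_x i) * var_y
        * ((\<Sum>i=1..a. var_x i) + var_y + of_nat (m * b) - 1) powi (int m - 2)"
proof -
  define u where "u k = (if k \<le> a then var_x k else 1)" for k
  define L where "L j = (\<Sum>i=1..<j. var_x i) + var_x j * var_y + (\<Sum>i=j+1..a. var_x i)" for j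
  have u1: "u k = 1" if "a < k" for k
    using that by (simp add: u_def)
  have letters: "{0<..a} = {1..a}"
    by auto
  have uX: "(\<Sum>k\<in>{0<..a}. u k) = (\<Sum>i=1..a. var_x i)"
    unfolding letters by (intro sum.cong) (auto simp: u_def)
  have uL: "(\<Sum>k\<in>{0<..a}. (u(j := var_x j * var_y)) k) = L j" if "j \<in> {1..a}" for j
  proof -
    have "(\<Sum>k\<in>{0<..a}. (u(j := var_x j * var_y)) k) = (\<Sum>k\<in>{0<..a}. (var_x(j := var_x j * var_y)) k)"
      using that by (intro sum.cong) (auto simp: u_def)
    also have "\<dots> = L j"
      unfolding L_def by (rule sum_marked_letter [OF that])
    finally show ?thesis .
  qed
  have uj: "u j = var_x j" if "j \<in> {1..a}" for j
    using that by (simp add: u_def)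
  have lhs: "(\<Sum>\<pi>\<in>parking_functions a b m. (\<Prod>i=1..a. var_x i ^ count_list \<pi> i) * var_y ^ lel \<pi>) =
      lel_enumerator u var_y 0 a b m"
    unfolding lel_enumerator_def parking_functions_eq_parking_words u_def
    by (intro sum.cong refl arg_cong2 [where f = "(*)"] prod_list_letters_eq_prod_count [symmetric])
       (auto simp: parking_words_def words_def)
  have "lel_enumerator u var_y 0 a b m =
     (\<Sum>j=1..a. var_x j * var_y * (L j + of_nat b) * (L j + of_nat (m * b)) powi (int m - 2))
     + of_nat (b * (m - 1)) * (\<Sum>i=1..a. var_x i) * var_y
        * ((\<Sum>i=1..a. var_x i) + var_y + of_nat (m * b) - 1) powi (int m - 2)"
  proof (cases "m = 1")
    case True
    have nz: "L j + of_nat b \<noteq> 0" for j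
      unfolding L_def var_x_def var_y_def using assms(2)
      by (intro no_constant_term_plus_of_nat_nonzero no_constant_term_add no_constant_term_sum
          no_constant_term_indet no_constant_term_indet_mult)
    have "lel_enumerator u var_y 0 a b (Suc 0) = (\<Sum>j\<in>{0<..a}. u j * var_y)"
      by (subst lel_enumerator_first_letter [OF _ u1])
         (simp_all add: lel_enumerator_def parking_words_no_small)
    also have "\<dots> = (\<Sum>j=1..a. var_x j * var_y)"
      unfolding letters by (intro sum.cong) (auto simp: u_def)
    finally show ?thesis
      using nz True by (simp add: mult.assoc)
  next
    case False
    then have "2 \<le> m"
      using assms(3) by simp
    then have "int m - 2 = int (m - 2)"
      by simp
    then have powi: "z powi (int m - 2) = z ^ (m - 2)" for z :: "qpoly fract"
      by (simp only: power_int_of_nat)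
    have "lel_enumerator u var_y 0 a b m =
      (\<Sum>j\<in>{0<..a}. u j * var_y * ((\<Sum>k\<in>{0<..a}. (u(j := u j * var_y)) k) + of_nat b) *
        ((\<Sum>k\<in>{0<..a}. (u(j := u j * var_y)) k) + of_nat (m * b)) ^ (m - 2)) +
      of_nat (b * (m - 1)) * (\<Sum>k\<in>{0<..a}. u k) * var_y *
        ((\<Sum>k\<in>{0<..a}. u k) + var_y + of_nat (m * b) - 1) ^ (m - 2)"
      using \<open>2 \<le> m\<close> by (intro lel_enumerator_eq u1) auto
    also have "(\<Sum>j\<in>{0<..a}. u j * var_y * ((\<Sum>k\<in>{0<..a}. (u(j := u j * var_y)) k) + of_nat b) *
        ((\<Sum>k\<in>{0<..a}. (u(j := u j * var_y)) k) + of_nat (m * b)) ^ (m - 2)) =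
      (\<Sum>j=1..a. var_x j * var_y * (L j + of_nat b) * (L j + of_nat (m * b)) ^ (m - 2))"
      by (intro sum.cong letters) (simp only: uL uj)
    finally show ?thesis
      unfolding powi uX .
  qed
  then show ?thesis
    unfolding lhs L_def .
qed

end
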